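(* Let $\ell$ be an odd integer with $\ell \geq 7$. Then $$\mathrm{ex}(Q_n, C_{2\ell}) = O\!\left(n^{\frac{5}{6} + \frac{1}{3(\ell-3)}}\, 2^n\right)$$ as $n \to \infty$ (with $\ell$ fixed).
   Context: The hypercube $Q_n$ is the graph with vertex set $\{A : A \subseteq [n]\}$, where $[n]=\{1,\dots,n\}$, and edge set consisting of all pairs $\{A,B\}$ with $A \subseteq B$ and $|A| = |B|-1$. For a graph $H$, $\mathrm{ex}(Q_n, H)$ denotes the largest number of edges in a subgraph $G$ of $Q_n$ such that no subgraph of $G$ is isomorphic to $H$. $C_{2\ell}$ denotes the cycle of length $2\ell$. *)

theory Defs
  imports "HOL-Library.Landau_Symbols"
begin

record 'a ugraph =
  verts :: "'a set"
  edges :: "'a set set"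

definition simple_graph :: "'a ugraph \<Rightarrow> bool" where
  "simple_graph G \<longleftrightarrow>
     (\<forall>e\<in>edges G. \<exists>u\<in>verts G. \<exists>v\<in>verts G. u \<noteq> v \<and> e = {u, v})"

definition subgraph :: "'a ugraph \<Rightarrow> 'a ugraph \<Rightarrow> bool" where
  "subgraph H G \<longleftrightarrow> simple_graph H \<and> verts H \<subseteq> verts G \<and> edges H \<subseteq> edges G"

definition graph_isomorphic :: "'a ugraph \<Rightarrow> 'b ugraph \<Rightarrow> bool" where
  "graph_isomorphic G H \<longleftrightarrow>
     (\<exists>f. bij_betw f (verts G) (verts H) \<and>
       (\<forall>u\<in>verts G. \<forall>v\<in>verts G. {u, v} \<in> edges G \<longleftrightarrow> {f u, f v} \<in> edges H))"

(* Not necessarily induced copies: any subgraph counts. *)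
definition contains_copy :: "'a ugraph \<Rightarrow> 'b ugraph \<Rightarrow> bool" where
  "contains_copy G H \<longleftrightarrow> (\<exists>F. subgraph F G \<and> graph_isomorphic F H)"

(* Meaningful when Q is finite and H has at least one vertex; see ex_number_well_defined. *)
definition ex_number :: "'a ugraph \<Rightarrow> 'b ugraph \<Rightarrow> nat" where
  "ex_number Q H = Max {card (edges G) | G. subgraph G Q \<and> \<not> contains_copy G H}"

(* The cardinality condition is written card B = card A + 1 because card A = card B - 1
   with truncated subtraction would also admit A = B = {}. *)
definition hypercube :: "nat \<Rightarrow> nat set ugraph" where
  "hypercube n =
     \<lparr> verts = {A. A \<subseteq> {1..n}},
       edges = {{A, B} | A B. A \<subseteq> {1..n} \<and> B \<subseteq> {1..n} \<and> A \<subseteq> B \<and> card B = card A + 1} \<rparr>"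

(* The cycle with k vertices; a genuine cycle for k >= 3. *)
definition cycle_graph :: "nat \<Rightarrow> nat ugraph" where
  "cycle_graph k = \<lparr> verts = {..<k}, edges = {{i, (i + 1) mod k} | i. i < k} \<rparr>"

lemma simple_graph_hypercube: "simple_graph (hypercube n)"
  unfolding simple_graph_def
proof
  fix e assume "e \<in> edges (hypercube n)"
  then obtain A B where "e = {A, B}" "A \<subseteq> {1..n}" "B \<subseteq> {1..n}" "card B = card A + 1"
    unfolding hypercube_def by auto
  moreover from this have "A \<noteq> B" by auto
  ultimately show "\<exists>u\<in>verts (hypercube n). \<exists>v\<in>verts (hypercube n). u \<noteq> v \<and> e = {u, v}"
    by (intro bexI[of _ A] bexI[of _ B]) (simp_all add: hypercube_def)
qed

lemma simple_graph_cycle_graph: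
  assumes "k \<ge> 3"
  shows "simple_graph (cycle_graph k)"
  unfolding simple_graph_def
proof
  fix e assume "e \<in> edges (cycle_graph k)"
  then obtain i where i: "e = {i, (i + 1) mod k}" "i < k"
    unfolding cycle_graph_def by auto
  then have "(i + 1) mod k < k" "i \<noteq> (i + 1) mod k"
    using assms by (cases "i + 1 = k"; simp)+
  with i show "\<exists>u\<in>verts (cycle_graph k). \<exists>v\<in>verts (cycle_graph k). u \<noteq> v \<and> e = {u, v}"
    by (intro bexI[of _ i] bexI[of _ "(i + 1) mod k"]) (simp_all add: cycle_graph_def)
qed

lemma finite_edges_hypercube: "finite (edges (hypercube n))"
proof -
  have "edges (hypercube n) \<subseteq> Pow (Pow {1..n})"
    unfolding hypercube_def by auto
  then show ?thesis by (rule finite_subset) simp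
qed

lemma ex_number_well_defined:
  assumes "finite (edges Q)" "verts H \<noteq> {}"
  shows "finite {card (edges G) | G. subgraph G Q \<and> \<not> contains_copy G H}"
    and "{card (edges G) | G. subgraph G Q \<and> \<not> contains_copy G H} \<noteq> {}"
proof -
  have "{card (edges G) | G. subgraph G Q \<and> \<not> contains_copy G H} \<subseteq> {..card (edges Q)}"
    using assms(1) by (auto simp: subgraph_def intro: card_mono)
  then show "finite {card (edges G) | G. subgraph G Q \<and> \<not> contains_copy G H}"
    by (rule finite_subset) simp
  let ?E = "\<lparr> verts = {}, edges = {} \<rparr>"
  have "subgraph ?E Q \<and> \<not> contains_copy ?E H"
    using assms(2)
    by (auto simp: subgraph_def simple_graph_def contains_copy_def graph_isomorphic_def bij_betw_def)
  then show "{card (edges G) | G. subgraph G Q \<and> \<not> contains_copy G H} \<noteq> {}"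
    by blast
qed

end

(* Fix a set A and call a triple T disjoint from A full if all three edges from A + T down to
   A + T - s (s in T) lie in G. Convexity gives many full triples over some A, and, for some x and y,
   many pairs uv such that both uvx and uvy are full: if G has more than C n^(5/6 + 1/(6k)) 2^n edges,
   where l = 2k + 3, there are more than C' n^(1 + 1/k) such pairs. By the Bondy-Simonovits theorem
   these pairs contain a cycle p_0, ..., p_(2k-1) with a pendant edge p_0 w. Then the l triples
   p_0 p_1 x, p_1 p_2 x, ..., p_(2k-1) p_0 x, p_0 w x, p_0 w y, p_0 p_1 y form a closed chain in which
   neighbours share pairs, all these pairs being distinct; triples and pairs alternate along a cycle
   of length 2l in the cube. *)
theory Submission
  imports Defs
begin

section \<open>Even cycles in graphs with many edges\<close>

text \<open>The obstacle is parity. With one apex x, a cycle of pairs uv such that uvx is full gives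
  a closed chain of equally many triples, but density n^(1 + 1/k) only forces cycles of even length.
  A second apex with the same pairs lets the chain switch from x to y across one edge at p_0 and
  back across another, which costs three more triples. For this p_0 w only has to differ from the
  two cycle edges at p_0; w itself may lie on the cycle. The exponent arises as follows. Two apices
  have O(n^(1 + 1/k)) pairs in common, and there are about n^2 choices of two apices, so by
  convexity one of the n^2 pairs uv has on average O(n^(1/2 + 1/(2k))) apices. Hence each A has
  O(n^(5/2 + 1/(2k))) full triples. The cube root of this bounds the average down-degree, and 6k =
  3(l - 3).\<close>

lemma min_degree_subset:
  fixes E :: "('a \<times> 'a) set"
  assumes "finite V" "E \<subseteq> V \<times> V" "sym E" "card E > 2 * d * card V"
  shows "\<exists>S\<subseteq>V. S \<noteq> {} \<and> (\<forall>v\<in>S. card (E `` {v} \<inter> S) > d)"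
  using assms
proof (induction "card V" arbitrary: V E rule: less_induct)
  case less
  show ?case
  proof (cases "\<forall>v\<in>V. card (E `` {v} \<inter> V) > d")
    case True
    have "V \<noteq> {}" using less.prems(2,4) by auto
    with True show ?thesis by (intro exI[of _ V]) simp
  next
    case False
    then obtain v where v: "v \<in> V" "card (E `` {v} \<inter> V) \<le> d" by force
    let ?N = "E `` {v}"
    have N: "?N \<inter> V = ?N" "finite ?N"
      using less.prems(1,2) by (auto intro: finite_subset[of _ V])
    \<comment> \<open>Deleting a vertex with at most \<open>d\<close> neighbours destroys at most
      \<open>2 * d\<close> ordered pairs, which is what \<open>2 * d * card V\<close> loses when
      \<open>card V\<close> drops by one. So the density hypothesis passes to
      \<open>E'\<close>.\<close>
    define E' where "E' = E \<inter> (V - {v}) \<times> (V - {v})"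
    have "E \<subseteq> E' \<union> ({v} \<times> ?N \<union> ?N \<times> {v})"
      using less.prems(2,3) by (auto simp: E'_def sym_def)
    moreover have fin: "finite E'"
      using less.prems(1) by (auto simp: E'_def)
    ultimately have "card E \<le> card (E' \<union> ({v} \<times> ?N \<union> ?N \<times> {v}))"
      using N by (intro card_mono) auto
    also have "\<dots> \<le> card E' + (card ({v} \<times> ?N) + card (?N \<times> {v}))"
      using card_Un_le[of E' "{v} \<times> ?N \<union> ?N \<times> {v}"] card_Un_le[of "{v} \<times> ?N" "?N \<times> {v}"]
      by linarith
    also have "\<dots> \<le> card E' + 2 * d"
      using v N by (simp add: card_cartesian_product)
    finally have "card E' + 2 * d > 2 * d * card V" using less.prems(4) by simp
    moreover have "card V = Suc (card (V - {v}))"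
      using v less.prems(1) by (metis card_Suc_Diff1)
    ultimately have c: "card E' > 2 * d * card (V - {v})" "card (V - {v}) < card V" by simp_all
    have "sym E'" using less.prems(3) by (auto simp: E'_def sym_def)
    from less.hyps[OF c(2) _ _ this c(1)] less.prems(1)
    obtain S where S: "S \<subseteq> V - {v}" "S \<noteq> {}" "\<forall>v\<in>S. card (E' `` {v} \<inter> S) > d"
      by (auto simp: E'_def)
    have "card (E `` {u} \<inter> S) > d" if "u \<in> S" for u
    proof -
      have "E' `` {u} \<inter> S \<subseteq> E `` {u} \<inter> S" by (auto simp: E'_def)
      moreover have "finite (E `` {u} \<inter> S)"
        using S(1) less.prems(1) by (auto intro: finite_subset)
      ultimately have "card (E' `` {u} \<inter> S) \<le> card (E `` {u} \<inter> S)" by (rule card_mono[rotated])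
      with S(3) that show ?thesis by fastforce
    qed
    moreover have "S \<subseteq> V" using S(1) by blast
    ultimately show ?thesis using S(2) by blast
  qed
qed

lemma exists_outside:
  assumes "finite U" "card U \<le> d" "card N > d"
  shows "\<exists>x\<in>N. x \<notin> U"
proof (rule ccontr)
  assume "\<not> ?thesis"
  then have "N \<subseteq> U" by blast
  from card_mono[OF assms(1) this] show False using assms(2,3) by linarith
qed

text \<open>Each new vertex has to avoid \<open>U\<close> and the path so far, at most
  \<open>card U + 2 * m\<close> vertices; since visited vertices are excluded explicitly,
  \<open>X\<close> and \<open>Y\<close> may overlap or coincide. In use, \<open>f\<close> is an
  ancestor map of a tree, and a step from \<open>X\<close> to \<open>Y\<close> and back preserves
  its value.\<close>

lemma greedy_alternating_path:
  assumes "sym E"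
    and degX: "\<And>x. x \<in> X \<Longrightarrow> card (E `` {x} \<inter> Y) > d"
    and degY: "\<And>y. y \<in> Y \<Longrightarrow> card (E `` {y} \<inter> X) > d"
    and f: "\<And>y x x'. \<lbrakk>y \<in> Y; x \<in> X; x' \<in> X; (y, x) \<in> E; (y, x') \<in> E\<rbrakk> \<Longrightarrow> f x = f x'"
    and U: "finite U" "card U + 2 * m \<le> d" and c: "c \<in> X" "c \<notin> U"
  shows "\<exists>q. length q = 2 * m + 1 \<and> hd q = c \<and> last q \<in> X \<and> distinct q \<and> set q \<inter> U = {} \<and>
    set q \<subseteq> X \<union> Y \<and> successively (\<lambda>u v. (u, v) \<in> E) q \<and> f (last q) = f c"
  using U(2)
proof (induction m)
  case 0
  then show ?case using c by (intro exI[of _ "[c]"]) auto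
next
  case (Suc m)
  then obtain q where q: "length q = 2 * m + 1" "hd q = c" "last q \<in> X" "distinct q"
    "set q \<inter> U = {}" "set q \<subseteq> X \<union> Y" "successively (\<lambda>u v. (u, v) \<in> E) q" "f (last q) = f c"
    by auto
  have cU: "card (U \<union> set q) \<le> card U + (2 * m + 1)"
    using card_Un_le[of U "set q"] q(1) card_length[of q] by linarith
  obtain y where y: "y \<in> E `` {last q} \<inter> Y" "y \<notin> U \<union> set q"
    using exists_outside[OF _ _ degX[OF q(3)], of "U \<union> set q"] cU Suc.prems U(1) by auto
  have "card (insert y (U \<union> set q)) \<le> card U + (2 * m + 2)"
    using cU y(2) U(1) by simp
  then obtain x where x: "x \<in> E `` {y} \<inter> X" "x \<notin> insert y (U \<union> set q)"
    using exists_outside[OF _ _ degY[of y], of "insert y (U \<union> set q)"] y Suc.prems U(1) by auto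
  have "q \<noteq> []" using q(1) by auto
  have "f x = f (last q)"
    using f[of y x "last q"] x y q(3) assms(1) by (auto simp: sym_def)
  then show ?case
    using q x y \<open>q \<noteq> []\<close>
    by (intro exI[of _ "q @ [y, x]"]) (auto simp: successively_append_iff)
qed

section \<open>Cycles closed through a rooted tree of levels\<close>

locale levelled_graph =
  fixes E :: "('a \<times> 'a) set" and L :: "nat \<Rightarrow> 'a set" and par :: "'a \<Rightarrow> 'a" and r :: 'a
  assumes sym: "sym E"
    and L0: "L 0 = {r}"
    and disj: "i \<noteq> j \<Longrightarrow> L i \<inter> L j = {}"
    and par: "v \<in> L (Suc i) \<Longrightarrow> par v \<in> L i \<and> (v, par v) \<in> E"
begin

lemma anc_level: "x \<in> L i \<Longrightarrow> t \<le> i \<Longrightarrow> (par ^^ t) x \<in> L (i - t)"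
proof (induction t)
  case (Suc t)
  then have "(par ^^ t) x \<in> L (Suc (i - Suc t))" by (simp add: Suc_diff_Suc)
  with par show ?case by simp
qed simp

lemma anc_edge: "x \<in> L i \<Longrightarrow> t < i \<Longrightarrow> ((par ^^ t) x, (par ^^ Suc t) x) \<in> E"
  using anc_level[of x i t] par[of "(par ^^ t) x" "i - Suc t"] by (simp add: Suc_diff_Suc)

lemma level_unique: "x \<in> L i \<Longrightarrow> x \<in> L j \<Longrightarrow> i = j"
  using disj by blast

lemma anc_mono: "(par ^^ s) x = (par ^^ s) x' \<Longrightarrow> s \<le> t \<Longrightarrow> (par ^^ t) x = (par ^^ t) x'"
  by (metis funpow_add o_apply le_add_diff_inverse2)

lemma anc_path:
  assumes "x \<in> L i" "t \<le> i"
  shows "successively (\<lambda>u v. (u, v) \<in> E) (map (\<lambda>s. (par ^^ s) x) [0..<Suc t])"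
  unfolding successively_conv_nth
  using assms anc_edge[OF assms(1)] by (auto simp del: upt_Suc funpow.simps)

text \<open>The tree supplies the return path: \<open>t\<close> vertices from the parent of
  \<open>z\<close> up to the common ancestor, then \<open>t - 1\<close> down to the parent of
  \<open>a\<close>. The hypothesis on \<open>t - 1\<close> makes this ancestor the first meeting
  point, so the branches are disjoint before it, and \<open>low\<close> keeps \<open>q\<close> off
  the levels that they traverse.\<close>

lemma close_path:
  assumes q: "distinct q" "successively (\<lambda>u v. (u, v) \<in> E) q" "q \<noteq> []"
    and hq: "hd q = a" "a \<in> L i" and lq: "last q = z" "z \<in> L i"
    and low: "\<And>j. j < i \<Longrightarrow> set q \<inter> L j = {}"
    and t: "0 < t" "t \<le> i" "(par ^^ t) a = (par ^^ t) z" "(par ^^ (t - 1)) a \<noteq> (par ^^ (t - 1)) z"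
  shows "\<exists>p. length p = length q + 2 * t - 1 \<and> distinct p \<and> p \<noteq> [] \<and>
    successively (\<lambda>u v. (u, v) \<in> E) p \<and> (last p, hd p) \<in> E"
proof -
  obtain t' where t': "t = Suc t'" using t(1) by (cases t) auto
  let ?up = "map (\<lambda>s. (par ^^ s) z) [1..<Suc t]"
  let ?dn = "rev (map (\<lambda>s. (par ^^ s) a) [1..<t])"
  let ?R = "\<lambda>u v. (u, v) \<in> E"
  define p where "p = q @ ?up @ ?dn"
  have ancL: "(par ^^ s) x \<in> L (i - s)" if "x \<in> {a, z}" "s \<le> t" for x s
    using anc_level[of x i s] that hq lq t(2) by auto
  have ne: "(par ^^ s) x \<noteq> (par ^^ s') x'" if "x \<in> {a, z}" "x' \<in> {a, z}" "s \<le> t" "s' \<le> t" "s \<noteq> s'" for x x' s s'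
    using level_unique[OF ancL[of x s]] ancL[of x' s'] that t(2) by fastforce
  have inj: "inj_on (\<lambda>s. (par ^^ s) x) {..t}" if "x \<in> {a, z}" for x
    by (rule inj_onI) (metis ne that atMost_iff)
  have "distinct ?up"
    unfolding distinct_map by (intro conjI inj_on_subset[OF inj]) auto
  moreover have "distinct ?dn"
    unfolding distinct_map distinct_rev by (intro conjI inj_on_subset[OF inj]) auto
  moreover have "set ?up \<inter> set ?dn = {}"
  proof (safe)
    fix w assume "w \<in> set ?up" "w \<in> set ?dn"
    from \<open>w \<in> set ?up\<close> obtain s where s: "w = (par ^^ s) z" "s \<in> {1..<Suc t}"
      unfolding set_map set_upt by (rule imageE)
    from \<open>w \<in> set ?dn\<close> obtain s' where s': "w = (par ^^ s') a" "s' \<in> {1..<t}"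
      unfolding set_rev set_map set_upt by (rule imageE)
    have "s = s'" using ne[of z a s s'] s s' by auto
    then have "(par ^^ s') a = (par ^^ s') z" using s(1) s'(1) by simp
    moreover have "s' \<le> t - 1" using s'(2) by auto
    ultimately have "(par ^^ (t - 1)) a = (par ^^ (t - 1)) z" by (rule anc_mono)
    with t(4) show "w \<in> {}" by auto
  qed
  moreover have "w \<notin> set q" if w: "w \<in> set ?up \<union> set ?dn" for w
  proof -
    from w have "w \<in> (\<lambda>s. (par ^^ s) z) ` {1..<Suc t} \<or> w \<in> (\<lambda>s. (par ^^ s) a) ` {1..<t}"
      by (simp only: set_map set_rev set_upt Un_iff)
    then obtain s x where "w = (par ^^ s) x" "1 \<le> s" "s \<le> t" "x \<in> {a, z}"
      by fastforce
    then have "w \<in> L (i - s)" "i - s < i" using ancL[of x s] t(1,2) by auto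
    then show ?thesis using low[of "i - s"] by auto
  qed
  ultimately have "distinct p" using q(1) by (auto simp: p_def simp del: upt_Suc funpow.simps)
  moreover have "length p = length q + 2 * t - 1" using t(1) by (simp add: p_def)
  moreover have "successively ?R p \<and> (last p, hd p) \<in> E"
  proof -
    have glue: "successively ?R (u @ w)" if "successively ?R u" "u \<noteq> []" "successively ?R (last u # w)" for u w
      using that by (cases w) (auto simp: successively_append_iff)
    have "successively ?R (map (\<lambda>s. (par ^^ s) z) [0..<Suc t])" by (rule anc_path[OF lq(2) t(2)])
    then have "successively ?R (z # ?up)" by (simp add: upt_conv_Cons del: upt_Suc)
    then have up: "successively ?R (q @ ?up)"
      using q(2,3) lq(1) by (cases ?up) (auto simp: successively_append_iff simp del: upt_Suc)
    have lastup: "last (q @ ?up) = (par ^^ t) a" using t(1,3) by simp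
    have "successively ?R (map (\<lambda>s. (par ^^ s) a) [0..<Suc t])" by (rule anc_path[OF hq(2) t(2)])
    then have "successively (\<lambda>u v. ?R v u) (map (\<lambda>s. (par ^^ s) a) [0..<Suc t])"
      using sym by (auto simp: sym_def successively_conv_nth)
    then have "successively ?R (rev (map (\<lambda>s. (par ^^ s) a) [0..<Suc t]))"
      by (simp only: successively_rev)
    moreover have "rev (map (\<lambda>s. (par ^^ s) a) [0..<Suc t]) = (par ^^ t) a # ?dn @ [a]"
      using t(1) by (simp add: upt_conv_Cons)
    ultimately have dn: "successively ?R ((par ^^ t) a # ?dn @ [a])" by simp
    have "successively ?R ((q @ ?up) @ ?dn @ [a])"
      using glue[of "q @ ?up" "?dn @ [a]"] up dn lastup q(3) by (simp only: append_is_Nil_conv simp_thms)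
    then have "successively ?R (p @ [a])" by (simp add: p_def)
    moreover have "p \<noteq> []" "hd p = a" using q(3) hq(1) by (simp_all add: p_def)
    ultimately show ?thesis by (simp add: successively_append_iff)
  qed
  ultimately show ?thesis using q(3) by (intro exI[of _ p]) (auto simp: p_def)
qed

lemma dense_levels_cycle:
  assumes X: "X \<subseteq> L i" "X \<noteq> {}" and Y: "\<And>j. j < i \<Longrightarrow> Y \<inter> L j = {}"
    and degX: "\<And>x. x \<in> X \<Longrightarrow> card (E `` {x} \<inter> Y) > 2 * k + 3"
    and degY: "\<And>y. y \<in> Y \<Longrightarrow> card (E `` {y} \<inter> X) > 2 * k + 3"
    and irr: "irrefl E"
    and k: "i < k"
  shows "\<exists>p. length p = 2 * k \<and> distinct p \<and> successively (\<lambda>u v. (u, v) \<in> E) p \<and> (last p, hd p) \<in> E"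
proof -
  let ?R = "\<lambda>u v. (u, v) \<in> E"
  \<comment> \<open>Take \<open>a\<close>, \<open>b\<close> with a common neighbour \<open>y\<close> whose branches in the tree merge as late as possible,
    after \<open>t\<close> steps. A greedy path from a third neighbour \<open>c\<close> of \<open>y\<close> cannot leave the common \<open>t\<close>-th
    ancestor, and its endpoint lies in a branch other than that of \<open>a\<close> or that of \<open>b\<close>. So it closes
    up through the tree to a cycle of the prescribed length.\<close>
  define Q where "Q t \<longleftrightarrow> (\<forall>y\<in>Y. \<forall>x\<in>X. \<forall>x'\<in>X. (y, x) \<in> E \<longrightarrow> (y, x') \<in> E \<longrightarrow> (par ^^ t) x = (par ^^ t) x')" for t
  define t where "t = (LEAST t. Q t)"
  have root: "(par ^^ i) x = r" if "x \<in> X" for x using anc_level[of x i i] that X L0 by auto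
  have "Q i" by (auto simp: Q_def root)
  then have Qt: "Q t" and ti: "t \<le> i" unfolding t_def by (auto intro: LeastI Least_le)
  obtain x0 where x0: "x0 \<in> X" using X by auto
  have "\<not> Q 0"
  proof
    assume Q0: "Q 0"
    obtain y where y: "y \<in> E `` {x0} \<inter> Y" using exists_outside[OF _ _ degX[OF x0], of "{}"] by auto
    obtain x where "x \<in> E `` {y} \<inter> X" "x \<noteq> x0" using exists_outside[OF _ _ degY, of "{x0}" y] y by auto
    then show False using Q0 y x0 sym by (auto simp: Q_def sym_def)
  qed
  then have t0: "0 < t" using Qt by (cases t) auto
  then have "\<not> Q (t - 1)" unfolding t_def using not_less_Least[of "t - 1" Q] by (simp add: t_def)
  then obtain y a b where yab: "y \<in> Y" "a \<in> X" "b \<in> X" "(y, a) \<in> E" "(y, b) \<in> E"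
    "(par ^^ (t - 1)) a \<noteq> (par ^^ (t - 1)) b" by (auto simp: Q_def)
  have "card {y, a, b} \<le> 3" by (simp add: card_insert_if)
  then obtain c where c: "c \<in> X" "(y, c) \<in> E" "c \<notin> {y, a, b}"
    using exists_outside[OF _ _ degY[OF yab(1)], of "{y, a, b}"] by auto
  have fin3: "finite {y, a, b}" by simp
  have card3: "card {y, a, b} + 2 * (k - t - 1) \<le> 2 * k + 3" using \<open>card {y, a, b} \<le> 3\<close> by simp
  have f: "(par ^^ t) x = (par ^^ t) x'" if "y \<in> Y" "x \<in> X" "x' \<in> X" "(y, x) \<in> E" "(y, x') \<in> E" for y x x'
    using Qt that unfolding Q_def by blast
  \<comment> \<open>Both \<open>a\<close> and \<open>b\<close> are kept off the path, since its
    endpoint decides which of them is used. That vertex, \<open>y\<close> and the path make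
    \<open>2 * (k - t - 1) + 3\<close> vertices, and the tree adds \<open>2 * t - 1\<close>, in all
    \<open>2 * k\<close>. The degree bound \<open>2 * k + 3\<close> pays for the path and the three
    excluded vertices.\<close>
  have "\<exists>q. length q = 2 * (k - t - 1) + 1 \<and> hd q = c \<and> last q \<in> X \<and> distinct q \<and>
      set q \<inter> {y, a, b} = {} \<and> set q \<subseteq> X \<union> Y \<and> successively ?R q \<and>
      (par ^^ t) (last q) = (par ^^ t) c"
    by (rule greedy_alternating_path[where d = "2 * k + 3"], rule sym, erule degX, erule degY,
        rule f, assumption+, rule fin3, rule card3, rule c(1), rule c(3))
  then obtain q where q: "length q = 2 * (k - t - 1) + 1" "hd q = c" "last q \<in> X" "distinct q"
    "set q \<inter> {y, a, b} = {}" "set q \<subseteq> X \<union> Y" "successively ?R q"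
    "(par ^^ t) (last q) = (par ^^ t) c"
    by blast
  have anc: "(par ^^ t) a = (par ^^ t) (last q)" "(par ^^ t) b = (par ^^ t) (last q)"
    using f[OF yab(1,2) c(1) yab(4) c(2)] f[OF yab(1,3) c(1) yab(5) c(2)] q(8) by (simp_all only:)
  obtain a' where a': "a' \<in> {a, b}" "(par ^^ (t - 1)) a' \<noteq> (par ^^ (t - 1)) (last q)"
    using yab(6) by (metis insertCI)
  have "q \<noteq> []" using q(1) by auto
  have "a' \<noteq> y" using a' yab(4,5) irr by (auto simp: irrefl_def)
  have dist: "distinct (a' # y # q)" using q(4,5) a'(1) \<open>a' \<noteq> y\<close> by auto
  have low: "set (a' # y # q) \<inter> L j = {}" if "j < i" for j
  proof -
    have "set (a' # y # q) \<subseteq> X \<union> Y" using a' yab q(6) by auto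
    moreover have "X \<inter> L j = {}" using X(1) disj[of i j] that by blast
    ultimately show ?thesis using Y[OF that] by blast
  qed
  have "(a', y) \<in> E" using a'(1) yab sym by (auto dest: symD)
  then have succ: "successively ?R (a' # y # q)"
    using q(2,7) c(2) by (cases q) auto
  have "a' \<in> L i" "last q \<in> L i" using a'(1) yab q(3) X by auto
  moreover have "(par ^^ t) a' = (par ^^ t) (last q)" using anc a'(1) by blast
  ultimately have "\<exists>p. length p = length (a' # y # q) + 2 * t - 1 \<and> distinct p \<and> p \<noteq> [] \<and>
      successively ?R p \<and> (last p, hd p) \<in> E"
    using \<open>q \<noteq> []\<close> by (intro close_path[OF dist succ _ _ _ _ _ low t0 ti _ a'(2)]) simp_all
  moreover have "length (a' # y # q) + 2 * t - 1 = 2 * k" using q(1) ti k t0 by simp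
  ultimately show ?thesis by metis
qed

end

text \<open>Without the cycle, the edges within a breadth-first layer and between consecutive layers
  are few up to depth \<open>k\<close>, so large degrees force each layer to be at least
  \<open>M\<close> times the preceding one, and layer \<open>k\<close> outgrows \<open>S\<close>.
  The 5 pays for the sparse parts: consecutive layer sizes a, b, c satisfy (M + 5) b \<le> a + 4 b +
  c, and a \<le> b.\<close>

lemma even_cycle_of_min_degree:
  fixes F :: "('a \<times> 'a) set"
  assumes fin: "finite S" and FS: "F \<subseteq> S \<times> S" and symF: "sym F" and irr: "irrefl F" and r: "r \<in> S"
    and deg: "\<And>v. v \<in> S \<Longrightarrow> card (F `` {v}) \<ge> (2 * k + 3) * (M + 5)"
    and M: "M \<ge> 1" "card S < M ^ k"
  shows "\<exists>p. length p = 2 * k \<and> distinct p \<and> successively (\<lambda>u v. (u, v) \<in> F) p \<and> (last p, hd p) \<in> F"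
proof (rule ccontr)
  assume nocyc: "\<not> ?thesis"
  define D where "D = 2 * k + 3"
  define L where "L i = {v. (r, v) \<in> F ^^ i \<and> (\<forall>j<i. (r, v) \<notin> F ^^ j)}" for i
  have disj: "L i \<inter> L j = {}" if "i \<noteq> j" for i j
    using that by (cases i j rule: linorder_cases) (auto simp: L_def)
  have exL: "\<exists>j\<le>i. v \<in> L j" if "(r, v) \<in> F ^^ i" for v i
  proof -
    let ?j = "LEAST j. (r, v) \<in> F ^^ j"
    have "v \<in> L ?j"
      using LeastI[of "\<lambda>j. (r, v) \<in> F ^^ j", OF that] not_less_Least[of _ "\<lambda>j. (r, v) \<in> F ^^ j"]
      by (auto simp: L_def)
    moreover have "?j \<le> i" using that by (rule Least_le)
    ultimately show ?thesis by blast
  qed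
  have nb1: "\<exists>j\<le>Suc i. u \<in> L j" if "v \<in> L i" "(v, u) \<in> F" for u v i
    using that exL[of u "Suc i"] by (auto simp: L_def)
  have nb: "\<exists>j. u \<in> L j \<and> j \<le> Suc i \<and> i \<le> Suc j" if vu: "v \<in> L i" "(v, u) \<in> F" for u v i
  proof -
    obtain j where j: "j \<le> Suc i" "u \<in> L j" using nb1[OF vu] by blast
    obtain i' where "i' \<le> Suc j" "v \<in> L i'" using nb1[OF j(2)] symD[OF symF vu(2)] by blast
    moreover then have "i' = i" using disj[of i' i] vu(1) by blast
    ultimately show ?thesis using j by blast
  qed
  have ex_par: "\<exists>u\<in>L i. (v, u) \<in> F" if v: "v \<in> L (Suc i)" for v i
  proof -
    have "(r, v) \<in> F ^^ Suc i" using v by (simp add: L_def)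
    then obtain u where u: "(r, u) \<in> F ^^ i" "(u, v) \<in> F" by auto
    then obtain j where j: "j \<le> i" "u \<in> L j" using exL by blast
    obtain j' where "j' \<le> Suc j" "v \<in> L j'" using nb1[OF j(2) u(2)] by blast
    moreover then have "j' = Suc i" using disj[of j' "Suc i"] v by blast
    ultimately have "j = i" using j by simp
    then show ?thesis using j u symD[OF symF] by blast
  qed
  \<comment> \<open>The quantifier over \<open>i\<close> lets one choice serve every layer without
    naming the layer of \<open>v\<close>; at the root it is vacuous.\<close>
  define par where "par v = (SOME u. (v, u) \<in> F \<and> (\<forall>i. v \<in> L (Suc i) \<longrightarrow> u \<in> L i))" for v
  interpret levelled_graph F L par r
  proof
    show "sym F" by fact
    show "L 0 = {r}" by (auto simp: L_def)
    show "L i \<inter> L j = {}" if "i \<noteq> j" for i j using disj that .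
    show "par v \<in> L i \<and> (v, par v) \<in> F" if v: "v \<in> L (Suc i)" for v i
    proof -
      obtain u where u: "u \<in> L i" "(v, u) \<in> F" using ex_par[OF v] by blast
      have "i' = i" if "v \<in> L (Suc i')" for i' using disj[of "Suc i'" "Suc i"] v that by blast
      with u have "(v, u) \<in> F \<and> (\<forall>i. v \<in> L (Suc i) \<longrightarrow> u \<in> L i)" by blast
      then have "(v, par v) \<in> F \<and> (\<forall>i. v \<in> L (Suc i) \<longrightarrow> par v \<in> L i)"
        unfolding par_def by (rule someI)
      with v show ?thesis by blast
    qed
  qed
  have LS: "L i \<subseteq> S" for i
  proof
    fix v assume "v \<in> L i"
    then show "v \<in> S" using L0 r par[of v] FS by (cases i) auto
  qed
  then have finL [simp]: "finite (L i)" for i using fin by (rule finite_subset)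
  have finF: "finite (F \<inter> A)" for A using FS fin by (meson finite_Int finite_SigmaI finite_subset)
  have nodense: False
    if "i < k" "X \<subseteq> L i" "X \<noteq> {}" "\<And>j. j < i \<Longrightarrow> Y \<inter> L j = {}"
       "\<And>x. x \<in> X \<Longrightarrow> card (F `` {x} \<inter> Y) > D" "\<And>y. y \<in> Y \<Longrightarrow> card (F `` {y} \<inter> X) > D" for i X Y
    using dense_levels_cycle[OF that(2,3,4) _ _ irr that(1)] that(5,6) nocyc
    unfolding D_def by blast
  have finN: "finite (F `` {x} \<inter> Y)" for x Y
    using FS by (intro finite_subset[OF _ fin]) auto
  \<comment> \<open>Too many edges inside a layer would yield a subset of large minimum degree,
    which serves as both \<open>X\<close> and \<open>Y\<close> in \<open>nodense\<close>.\<close>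
  have inside: "card (F \<inter> L i \<times> L i) \<le> 2 * D * card (L i)" if i: "i < k" for i
  proof (rule ccontr)
    let ?E = "F \<inter> L i \<times> L i"
    assume "\<not> ?thesis"
    then have c: "2 * D * card (L i) < card ?E" by simp
    have "sym ?E" using symF by (auto simp: sym_def)
    from min_degree_subset[OF finL _ this c]
    obtain X where X: "X \<subseteq> L i" "X \<noteq> {}" "\<forall>v\<in>X. D < card (?E `` {v} \<inter> X)" by auto
    have "D < card (F `` {v} \<inter> X)" if "v \<in> X" for v
    proof -
      have "?E `` {v} \<inter> X = F `` {v} \<inter> X" using X(1) that by auto
      then show ?thesis using X(3) that by metis
    qed
    moreover have "X \<inter> L j = {}" if "j < i" for j using X(1) disj[of i j] that by blast
    ultimately show False using nodense[OF i X(1,2), of X] by blast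
  qed
  have between: "card (F \<inter> L i \<times> L (Suc i)) \<le> D * (card (L i) + card (L (Suc i)))" if i: "i < k" for i
  proof (rule ccontr)
    let ?U = "F \<inter> L i \<times> L (Suc i)"
    \<comment> \<open>Symmetrizing doubles the number of pairs, which the factor 2 in
      \<open>min_degree_subset\<close> absorbs. Of the resulting set, the part nearer to the root
      must play \<open>X\<close>, because \<open>nodense\<close> keeps \<open>Y\<close> out of all
      layers before that of \<open>X\<close>.\<close>
    let ?E = "?U \<union> ?U\<inverse>"
    assume "\<not> ?thesis"
    then have c: "D * (card (L i) + card (L (Suc i))) < card ?U" by simp
    have d: "L i \<inter> L (Suc i) = {}" using disj by simp
    then have "card ?E = 2 * card ?U" using finF by (subst card_Un_disjoint) auto
    moreover have "card (L i \<union> L (Suc i)) = card (L i) + card (L (Suc i))"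
      using d by (simp add: card_Un_disjoint)
    ultimately have c': "2 * D * card (L i \<union> L (Suc i)) < card ?E" using c by simp
    have "sym ?E" by (auto simp: sym_def)
    from min_degree_subset[OF _ _ this c']
    obtain Z where Z: "Z \<subseteq> L i \<union> L (Suc i)" "Z \<noteq> {}" "\<forall>v\<in>Z. D < card (?E `` {v} \<inter> Z)" by auto
    have x: "D < card (F `` {x} \<inter> (Z \<inter> L (Suc i)))" if "x \<in> Z \<inter> L i" for x
    proof -
      have "?E `` {x} \<inter> Z \<subseteq> F `` {x} \<inter> (Z \<inter> L (Suc i))" using d that by auto
      then have "card (?E `` {x} \<inter> Z) \<le> card (F `` {x} \<inter> (Z \<inter> L (Suc i)))"
        by (rule card_mono[OF finN])
      then show ?thesis using Z(3) that by fastforce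
    qed
    have y: "D < card (F `` {x} \<inter> (Z \<inter> L i))" if "x \<in> Z \<inter> L (Suc i)" for x
    proof -
      have "?E `` {x} \<inter> Z \<subseteq> F `` {x} \<inter> (Z \<inter> L i)" using d that symF by (auto dest: symD)
      then have "card (?E `` {x} \<inter> Z) \<le> card (F `` {x} \<inter> (Z \<inter> L i))"
        by (rule card_mono[OF finN])
      then show ?thesis using Z(3) that by fastforce
    qed
    have "Z \<inter> L i \<noteq> {}"
    proof
      assume e: "Z \<inter> L i = {}"
      with Z(1,2) obtain z where "z \<in> Z \<inter> L (Suc i)" by blast
      from y[OF this] e show False by simp
    qed
    moreover have "Z \<inter> L (Suc i) \<inter> L j = {}" if "j < i" for j using disj[of "Suc i" j] that by auto
    ultimately show False using nodense[OF i, of "Z \<inter> L i" "Z \<inter> L (Suc i)"] x y by blast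
  qed
  have degsum: "D * (M + 5) * card (L i) \<le> card (F \<inter> L i \<times> UNIV)" for i
  proof -
    have "F \<inter> L i \<times> UNIV = (SIGMA v:L i. F `` {v})" by auto
    moreover have "card (SIGMA v:L i. F `` {v}) = (\<Sum>v\<in>L i. card (F `` {v}))"
      using finN[of _ UNIV] by (subst card_SigmaI) auto
    moreover have "(\<Sum>v\<in>L i. D * (M + 5)) \<le> (\<Sum>v\<in>L i. card (F `` {v}))"
      using LS deg by (intro sum_mono) (auto simp: D_def)
    ultimately show ?thesis by (simp add: mult.commute)
  qed
  have D0: "D > 0" by (simp add: D_def)
  have growth: "M * card (L i) \<le> card (L (Suc i))" if "i < k" for i
    using that
  proof (induction i)
    case 0
    have "F \<inter> L 0 \<times> UNIV \<subseteq> (F \<inter> L 0 \<times> L 0) \<union> (F \<inter> L 0 \<times> L (Suc 0))"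
      using nb[of _ 0] by (fastforce simp: le_Suc_eq)
    then have "card (F \<inter> L 0 \<times> UNIV) \<le> card ((F \<inter> L 0 \<times> L 0) \<union> (F \<inter> L 0 \<times> L (Suc 0)))"
      by (intro card_mono) (auto simp: finF)
    also have "\<dots> \<le> card (F \<inter> L 0 \<times> L 0) + card (F \<inter> L 0 \<times> L (Suc 0))" by (rule card_Un_le)
    also have "\<dots> \<le> 2 * D * card (L 0) + D * (card (L 0) + card (L (Suc 0)))"
      by (intro add_mono inside between 0)
    finally have "D * (M + 5) * card (L 0) \<le> 2 * D * card (L 0) + D * (card (L 0) + card (L (Suc 0)))"
      using degsum[of 0] by linarith
    then have "D * ((M + 5) * card (L 0)) \<le> D * (3 * card (L 0) + card (L (Suc 0)))"
      by (simp add: algebra_simps)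
    then have "(M + 5) * card (L 0) \<le> 3 * card (L 0) + card (L (Suc 0))"
      using D0 by (simp only: mult_le_cancel1)
    then show ?case by (simp add: algebra_simps)
  next
    case (Suc i)
    let ?a = "card (L i)" and ?b = "card (L (Suc i))" and ?c = "card (L (Suc (Suc i)))"
    have i: "i < k" using Suc.prems by simp
    have ab: "?a \<le> ?b" using Suc.IH[OF i] M(1) by (metis le_trans mult_le_mono1 mult_1)
    have "F \<inter> L (Suc i) \<times> UNIV \<subseteq>
        (F \<inter> L i \<times> L (Suc i))\<inverse> \<union> ((F \<inter> L (Suc i) \<times> L (Suc i)) \<union> (F \<inter> L (Suc i) \<times> L (Suc (Suc i))))"
    proof
      fix e assume "e \<in> F \<inter> L (Suc i) \<times> UNIV"
      then obtain v u where e: "e = (v, u)" "(v, u) \<in> F" "v \<in> L (Suc i)" by auto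
      obtain j where j: "u \<in> L j" "j \<le> Suc (Suc i)" "Suc i \<le> Suc j" using nb[OF e(3,2)] by blast
      then have "j = i \<or> j = Suc i \<or> j = Suc (Suc i)" by auto
      then show "e \<in> (F \<inter> L i \<times> L (Suc i))\<inverse> \<union> ((F \<inter> L (Suc i) \<times> L (Suc i)) \<union> (F \<inter> L (Suc i) \<times> L (Suc (Suc i))))"
        using e j(1) symD[OF symF] by auto
    qed
    then have "card (F \<inter> L (Suc i) \<times> UNIV) \<le> card ((F \<inter> L i \<times> L (Suc i))\<inverse> \<union>
        ((F \<inter> L (Suc i) \<times> L (Suc i)) \<union> (F \<inter> L (Suc i) \<times> L (Suc (Suc i)))))"
      by (intro card_mono) (auto simp: finF)
    also have "\<dots> \<le> card ((F \<inter> L i \<times> L (Suc i))\<inverse>) +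
        (card (F \<inter> L (Suc i) \<times> L (Suc i)) + card (F \<inter> L (Suc i) \<times> L (Suc (Suc i))))"
      by (rule order_trans[OF card_Un_le add_left_mono[OF card_Un_le]])
    also have "\<dots> \<le> D * (?a + ?b) + (2 * D * ?b + D * (?b + ?c))"
      unfolding card_inverse by (intro add_mono inside between Suc.prems i)
    finally have "D * (M + 5) * ?b \<le> D * (?a + ?b) + (2 * D * ?b + D * (?b + ?c))"
      using degsum[of "Suc i"] by linarith
    then have "D * ((M + 5) * ?b) \<le> D * (?a + 4 * ?b + ?c)"
      by (simp add: algebra_simps)
    then have "(M + 5) * ?b \<le> ?a + 4 * ?b + ?c"
      using D0 by (simp only: mult_le_cancel1)
    then show ?case using ab by (simp add: algebra_simps)
  qed
  have "M ^ i \<le> card (L i)" if "i \<le> k" for i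
    using that
  proof (induction i)
    case 0
    then show ?case by (simp add: L0)
  next
    case (Suc i)
    then show ?case using growth[of i] by (simp add: Suc_le_eq) (meson le_trans mult_le_mono2)
  qed
  then have "M ^ k \<le> card (L k)" by simp
  also have "\<dots> \<le> card S" using LS fin by (rule card_mono[rotated])
  finally show False using M(2) by simp
qed

lemma even_cycle_with_pendant_edge:
  fixes E :: "('a \<times> 'a) set"
  assumes "finite V" "E \<subseteq> V \<times> V" "sym E" "irrefl E" "k \<ge> 1" "M \<ge> 1" "card V < M ^ k"
    and "card E > 2 * ((2 * k + 3) * (M + 5)) * card V"
  shows "\<exists>p w. length p = 2 * k \<and> distinct p \<and> successively (\<lambda>u v. (u, v) \<in> E) p \<and>
    (last p, hd p) \<in> E \<and> (hd p, w) \<in> E \<and> w \<noteq> p ! 1 \<and> w \<noteq> last p"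
proof -
  let ?d = "(2 * k + 3) * (M + 5)"
  obtain S where S: "S \<subseteq> V" "S \<noteq> {}" "\<forall>v\<in>S. card (E `` {v} \<inter> S) > ?d"
    using min_degree_subset[OF assms(1,2,3,8)] by auto
  define F where "F = E \<inter> S \<times> S"
  have FN: "F `` {v} = E `` {v} \<inter> S" if "v \<in> S" for v using that by (auto simp: F_def)
  obtain r where r: "r \<in> S" using S(2) by blast
  have finS: "finite S" using S(1) assms(1) by (rule finite_subset)
  have "card S < M ^ k" using card_mono[OF assms(1) S(1)] assms(7) by simp
  moreover have "sym F" "irrefl F" "F \<subseteq> S \<times> S"
    using assms(3,4) by (auto simp: F_def sym_def irrefl_def)
  moreover have "card (F `` {v}) \<ge> ?d" if "v \<in> S" for v
    using S(3) that FN[OF that] by (simp add: less_imp_le)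
  ultimately obtain p where p: "length p = 2 * k" "distinct p" "successively (\<lambda>u v. (u, v) \<in> F) p"
    "(last p, hd p) \<in> F"
    using even_cycle_of_min_degree[OF finS _ _ _ r _ assms(6)] by blast
  have "hd p \<in> S" using p(4) by (auto simp: F_def)
  \<comment> \<open>More than \<open>?d\<close> neighbours in \<open>S\<close> means at least three,
    so one is left besides the two neighbours of \<open>hd p\<close> along the cycle.\<close>
  moreover have "1 * 2 \<le> ?d" by (rule mult_le_mono) simp_all
  then have "card {p ! 1, last p} \<le> ?d"
    by (rule order_trans[rotated]) (simp add: card_insert_if)
  ultimately obtain w where w: "w \<in> E `` {hd p} \<inter> S" "w \<notin> {p ! 1, last p}"
    using exists_outside[of "{p ! 1, last p}" ?d "E `` {hd p} \<inter> S"] S(3) by auto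
  have "successively (\<lambda>u v. (u, v) \<in> E) p"
    using p(3) by (rule successively_mono) (simp add: F_def)
  then show ?thesis using p w by (intro exI[of _ p] exI[of _ w]) (auto simp: F_def)
qed

section \<open>From chains of triples to cycles in the cube\<close>

lemma contains_cycle_graph:
  assumes G: "simple_graph G" and inj: "inj_on c {..<m}" and m: "m \<ge> 3"
    and e: "\<And>i. i < m \<Longrightarrow> {c i, c (Suc i mod m)} \<in> edges G"
  shows "contains_copy G (cycle_graph m)"
proof -
  \<comment> \<open>Only the images of cycle edges are taken, not all edges of \<open>G\<close>
    among these vertices, because \<open>graph_isomorphic\<close> also requires non-edges to
    correspond.\<close>
  define F where "F = \<lparr>verts = c ` {..<m}, edges = (`) c ` edges (cycle_graph m)\<rparr>"
  have cyc: "edges (cycle_graph m) \<subseteq> Pow {..<m}" by (auto simp: cycle_graph_def)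
  have eG: "edges F \<subseteq> edges G" using e by (auto simp: F_def cycle_graph_def)
  have vG: "verts F \<subseteq> verts G"
  proof
    fix v assume "v \<in> verts F"
    then obtain i where i: "i < m" "v = c i" by (auto simp: F_def)
    with e[of i] G show "v \<in> verts G" by (fastforce simp: simple_graph_def doubleton_eq_iff)
  qed
  have "simple_graph F"
    unfolding simple_graph_def
  proof
    fix e assume "e \<in> edges F"
    then obtain e' where e': "e' \<in> edges (cycle_graph m)" "e = c ` e'" by (auto simp: F_def)
    then obtain u v where "u \<in> verts (cycle_graph m)" "v \<in> verts (cycle_graph m)" "u \<noteq> v" "e' = {u, v}"
      using simple_graph_cycle_graph[OF m] unfolding simple_graph_def by blast
    then have uv: "u < m" "v < m" "u \<noteq> v" "e' = {u, v}" by (simp_all add: cycle_graph_def)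
    from uv(1-3) have "c u \<noteq> c v" using inj by (auto simp: inj_on_def)
    with uv e' show "\<exists>u\<in>verts F. \<exists>v\<in>verts F. u \<noteq> v \<and> e = {u, v}" by (auto simp: F_def)
  qed
  with vG eG have "subgraph F G" by (simp add: subgraph_def)
  moreover have "graph_isomorphic F (cycle_graph m)"
    unfolding graph_isomorphic_def
  proof (intro exI conjI ballI)
    show "bij_betw (inv_into {..<m} c) (verts F) (verts (cycle_graph m))"
      using bij_betw_inv_into[of c "{..<m}" "verts F"] inj
      by (simp add: F_def cycle_graph_def bij_betw_def)
    fix u v assume "u \<in> verts F" "v \<in> verts F"
    then obtain a b where ab: "a < m" "b < m" "u = c a" "v = c b" by (auto simp: F_def)
    have "{u, v} \<in> edges F \<longleftrightarrow> c ` {a, b} \<in> (`) c ` edges (cycle_graph m)"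
      using ab by (simp add: F_def)
    also have "\<dots> \<longleftrightarrow> {a, b} \<in> edges (cycle_graph m)"
      using ab by (intro inj_on_image_mem_iff[OF inj_on_image_Pow[OF inj] _ cyc]) auto
    finally show "{u, v} \<in> edges F \<longleftrightarrow>
        {inv_into {..<m} c u, inv_into {..<m} c v} \<in> edges (cycle_graph m)"
      using ab inj by simp
  qed
  ultimately show ?thesis unfolding contains_copy_def by blast
qed

definition full_triple :: "nat set ugraph \<Rightarrow> nat set \<Rightarrow> nat set \<Rightarrow> bool" where
  "full_triple G A T \<longleftrightarrow> card T = 3 \<and> A \<inter> T = {} \<and> (\<forall>s\<in>T. {A \<union> T - {s}, A \<union> T} \<in> edges G)"

lemma full_triple_edge:
  assumes "full_triple G A T" "P \<subseteq> T" "card P = 2"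
  shows "{A \<union> P, A \<union> T} \<in> edges G"
proof -
  have T: "finite T" "card T = 3" using assms(1) by (auto simp: full_triple_def intro: card_ge_0_finite)
  then have "card (T - P) = 1" using assms(2,3) by (simp add: card_Diff_subset finite_subset)
  then obtain s where s: "T - P = {s}" by (auto simp: card_1_singleton_iff)
  then have "A \<union> T - {s} = A \<union> P" "s \<in> T" using assms(1,2) by (auto simp: full_triple_def)
  then show ?thesis using assms(1) unfolding full_triple_def by metis
qed

text \<open>\<open>P i\<close> is the pair shared by consecutive triples, so adding \<open>A\<close>
  gives a common neighbour of the two vertices coming from them. All these sets are disjoint from
  \<open>A\<close>, so removing \<open>A\<close> recovers them, and size 3 or 2 tells triples from
  pairs; hence distinctness within each kind is enough.\<close>

lemma simplicial_cycle_copy: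
  assumes G: "simple_graph G" and l: "l \<ge> 2"
    and injT: "inj_on T {..<l}" and injP: "inj_on P {..<l}"
    and T: "\<And>i. i < l \<Longrightarrow> full_triple G A (T i)"
    and P: "\<And>i. i < l \<Longrightarrow> card (P i) = 2 \<and> P i \<subseteq> T i \<and> P i \<subseteq> T (Suc i mod l)"
  shows "contains_copy G (cycle_graph (2 * l))"
proof -
  define c where "c j = A \<union> (if even j then T (j div 2) else P (j div 2))" for j
  have TA: "c j - A = T (j div 2)" if "j < 2 * l" "even j" for j
    using T[of "j div 2"] that less_mult_imp_div_less[of j l 2]
    by (auto simp: c_def full_triple_def mult.commute)
  have PA: "c j - A = P (j div 2)" if "j < 2 * l" "odd j" for j
    using T[of "j div 2"] P[of "j div 2"] that less_mult_imp_div_less[of j l 2]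
    by (auto simp: c_def full_triple_def mult.commute)
  have "inj_on c {..<2 * l}"
  proof (rule inj_onI)
    fix i j assume ij: "i \<in> {..<2 * l}" "j \<in> {..<2 * l}" "c i = c j"
    have lt: "i div 2 < l" "j div 2 < l" using ij by auto
    have "i div 2 = j div 2 \<and> (even i \<longleftrightarrow> even j)"
    proof (cases "even i"; cases "even j")
      assume "even i" "even j"
      then have "T (i div 2) = T (j div 2)" using TA[of i] TA[of j] ij by simp
      then show ?thesis using injT lt \<open>even i\<close> \<open>even j\<close> by (auto simp: inj_on_def)
    next
      assume "odd i" "odd j"
      then have "P (i div 2) = P (j div 2)" using PA[of i] PA[of j] ij by simp
      then show ?thesis using injP lt \<open>odd i\<close> \<open>odd j\<close> by (auto simp: inj_on_def)
    next
      assume "even i" "odd j"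
      then have "T (i div 2) = P (j div 2)" using TA[of i] PA[of j] ij by simp
      then show ?thesis using T[OF lt(1)] P[OF lt(2)] by (simp add: full_triple_def)
    next
      assume "odd i" "even j"
      then have "P (i div 2) = T (j div 2)" using PA[of i] TA[of j] ij by simp
      then show ?thesis using P[OF lt(1)] T[OF lt(2)] by (simp add: full_triple_def)
    qed
    then show "i = j" by presburger
  qed
  moreover have "{c j, c (Suc j mod (2 * l))} \<in> edges G" if j: "j < 2 * l" for j
  proof (cases "even j")
    case True
    then obtain i where i: "j = 2 * i" by (auto elim: evenE)
    then have "Suc j mod (2 * l) = 2 * i + 1" using j by auto
    then show ?thesis
      using full_triple_edge[OF T, of i "P i"] P[of i] i j by (simp add: c_def insert_commute)
  next
    case False
    then obtain i where i: "j = 2 * i + 1" by (auto elim: oddE)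
    then have "Suc j mod (2 * l) = 2 * (Suc i mod l)" using mult_mod_right[of 2 "Suc i" l] by simp
    then show ?thesis
      using full_triple_edge[OF T, of "Suc i mod l" "P i"] P[of i] i j l by (simp add: c_def)
  qed
  ultimately show ?thesis using l by (intro contains_cycle_graph[OF G]) auto
qed

lemma full_triple_distinct: "full_triple G A {u, v, x} \<Longrightarrow> u \<noteq> v \<and> u \<noteq> x \<and> v \<noteq> x"
  by (auto simp: full_triple_def card_insert_if split: if_splits)

text \<open>The detour via \<open>w\<close> from apex \<open>x\<close> to apex \<open>y\<close> adds three triples to the even cycle, which is
  what makes the length odd.\<close>

lemma cycle_copy_of_common_link:
  assumes G: "simple_graph G" and k: "k \<ge> 2" and xy: "x \<noteq> y"
    and E: "E = {(u, v). full_triple G A {u, v, x} \<and> full_triple G A {u, v, y}}"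
    and p: "length p = 2 * k" "distinct p" "successively (\<lambda>u v. (u, v) \<in> E) p" "(last p, hd p) \<in> E"
    and w: "(hd p, w) \<in> E" "w \<noteq> p ! 1" "w \<noteq> last p"
  shows "contains_copy G (cycle_graph (2 * (2 * k + 3)))"
proof -
  \<comment> \<open>Reading indices cyclically turns the closing edge into the ordinary edge from
    \<open>q (2 * k - 1)\<close> to \<open>q (2 * k)\<close>, where
    \<open>q (2 * k) = q 0\<close>.\<close>
  define q where "q i = p ! (i mod (2 * k))" for i
  have pne: "p \<noteq> []" using p(1) k by auto
  have q0: "q 0 = hd p" "q (2 * k) = hd p" "q (2 * k - 1) = last p" "q (Suc 0) = p ! 1"
    using pne p(1) k by (simp_all add: q_def hd_conv_nth last_conv_nth)
  have qinj: "q i = q j \<longleftrightarrow> i = j" if "i < 2 * k" "j < 2 * k" for i j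
    using p(1,2) that by (simp add: q_def nth_eq_iff_index_eq)
  have qE: "(q i, q (Suc i)) \<in> E" if "i < 2 * k" for i
  proof (cases "Suc i = 2 * k")
    case True
    then have "i = 2 * k - 1" by simp
    then show ?thesis using p(4) q0 True by simp
  next
    case False
    then have "Suc i < length p" using that p(1) by simp
    from successively_nth[OF p(3) this] show ?thesis using that False by (simp add: q_def)
  qed
  have full: "full_triple G A {q i, q (Suc i), x}" "full_triple G A {q i, q (Suc i), y}"
    if "i < 2 * k" for i using qE[OF that] by (auto simp: E)
  have fw: "full_triple G A {q 0, w, x}" "full_triple G A {q 0, w, y}"
    using w(1) q0 by (auto simp: E)
  note wd = full_triple_distinct[OF fw(1)] full_triple_distinct[OF fw(2)]
  have f0: "full_triple G A {q 0, q (Suc 0), y}" using full(2)[of 0] k by simp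
  have qx: "q i \<noteq> x" "q i \<noteq> y" if "i \<le> 2 * k" for i
  proof -
    have "q i \<noteq> x \<and> q i \<noteq> y"
    proof (cases "i = 2 * k")
      case True
      then show ?thesis using wd q0(1,2) by (simp only:) simp
    next
      case False
      then have "i < 2 * k" using that by simp
      from full_triple_distinct[OF full(1)[OF this]] full_triple_distinct[OF full(2)[OF this]]
      show ?thesis by blast
    qed
    then show "q i \<noteq> x" "q i \<noteq> y" by blast+
  qed
  have q01: "q 0 \<noteq> q (Suc 0)" using qinj[of 0 "Suc 0"] k by simp
  have wq: "w \<noteq> q (Suc 0)" "w \<noteq> q (2 * k - 1)" using w q0 by auto
  have qSuc: "q (Suc i) = q (Suc j) \<longleftrightarrow> i = j" if "i < 2 * k" "j < 2 * k" for i j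
    using qinj[of "Suc i" "Suc j"] qinj[of 0 "Suc j"] qinj[of "Suc i" 0] q0 that
    by (cases "Suc i = 2 * k"; cases "Suc j = 2 * k") auto
  \<comment> \<open>Two positions giving the same edge in opposite directions would force a cycle of
    length 2, which \<open>k \<ge> 2\<close> excludes.\<close>
  have dbl: "{q i, q (Suc i)} \<noteq> {q j, q (Suc j)}" if "i < j" "j < 2 * k" for i j
  proof
    assume "{q i, q (Suc i)} = {q j, q (Suc j)}"
    then have "q i = q (Suc j) \<and> q (Suc i) = q j" using qinj[of i j] that by (auto simp: doubleton_eq_iff)
    then show False
      using qinj[of i "Suc j"] qinj[of "Suc i" j] qinj[of i 0] q0 that k
      by (cases "Suc j = 2 * k") auto
  qed
  have dblw: "{q i, q (Suc i)} \<noteq> {q 0, w}" if "i < 2 * k" for i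
  proof
    assume "{q i, q (Suc i)} = {q 0, w}"
    then consider "q i = q 0" "q (Suc i) = w" | "q i = w" "q (Suc i) = q 0"
      by (auto simp: doubleton_eq_iff)
    then show False
    proof cases
      case 1
      then show False using qinj[of i 0] that wq by auto
    next
      case 2
      then have "Suc i = 2 * k" using qinj[of "Suc i" 0] that by (cases "Suc i = 2 * k") auto
      then have "i = 2 * k - 1" by simp
      then show False using 2 wq by simp
    qed
  qed
  \<comment> \<open>Indices from \<open>2 * k\<close> on form the detour: \<open>x\<close> is
    exchanged for \<open>y\<close> across \<open>{q 0, w}\<close>, and \<open>y\<close> for
    \<open>x\<close> across \<open>{q 0, q (Suc 0)}\<close>, which leads back to \<open>T 0\<close>.
    \<open>P i\<close> is the pair on the way from \<open>T i\<close> to its successor.\<close>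
  define T where "T i = (if i < 2 * k then {q i, q (Suc i), x} else if i = 2 * k then {q 0, w, x}
    else if i = 2 * k + 1 then {q 0, w, y} else {q 0, q (Suc 0), y})" for i
  define P where "P i = (if i < 2 * k then {q (Suc i), x} else if i = 2 * k then {q 0, w}
    else if i = 2 * k + 1 then {q 0, y} else {q 0, q (Suc 0)})" for i
  have "inj_on T {..<2 * k + 3}"
  proof (rule linorder_inj_onI)
    fix i j assume ij: "i < j" "i \<in> {..<2 * k + 3}" "j \<in> {..<2 * k + 3}"
    \<comment> \<open>The triples up to index \<open>2 * k\<close> contain \<open>x\<close> and the
      later ones do not. Within either group the common apex can be removed, which leaves distinct
      edges of the link graph.\<close>
    have "j < 2 * k \<or> (i < 2 * k \<and> j = 2 * k) \<or> (i \<le> 2 * k \<and> j > 2 * k) \<or> (i = 2 * k + 1 \<and> j = 2 * k + 2)"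
      using ij unfolding lessThan_iff by linarith
    then consider "j < 2 * k" | "i < 2 * k" "j = 2 * k" | "i \<le> 2 * k" "j > 2 * k" | "i = 2 * k + 1" "j = 2 * k + 2"
      by blast
    then show "T i \<noteq> T j"
    proof cases
      case 1
      have nin: "x \<notin> {q i, q (Suc i)}" "x \<notin> {q j, q (Suc j)}"
        using qx(1)[of i] qx(1)[of "Suc i"] qx(1)[of j] qx(1)[of "Suc j"] ij(1) 1 by auto
      have eq: "T i = insert x {q i, q (Suc i)}" "T j = insert x {q j, q (Suc j)}"
        using 1 ij(1) by (simp_all add: T_def insert_commute)
      show ?thesis unfolding eq insert_ident[OF nin] by (rule dbl[OF ij(1) 1])
    next
      case 2
      have nin: "x \<notin> {q i, q (Suc i)}" "x \<notin> {q 0, w}"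
        using qx(1)[of i] qx(1)[of "Suc i"] wd 2 by auto
      have eq: "T i = insert x {q i, q (Suc i)}" "T j = insert x {q 0, w}"
        using 2 by (simp_all add: T_def insert_commute)
      show ?thesis unfolding eq insert_ident[OF nin] by (rule dblw[OF 2(1)])
    next
      case 3
      then have "x \<in> T i" by (simp add: T_def)
      moreover have "x \<notin> {q 0, q (Suc 0), w, y}" using xy wd qx(1)[of "Suc 0"] k by auto
      then have "x \<notin> T j" using 3(2) by (simp add: T_def)
      ultimately show ?thesis by blast
    next
      case 4
      have nin: "y \<notin> {q 0, w}" "y \<notin> {q 0, q (Suc 0)}" using wd qx(2)[of "Suc 0"] k by auto
      have eq: "T i = insert y {q 0, w}" "T j = insert y {q 0, q (Suc 0)}"
        using 4 by (simp_all add: T_def insert_commute)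
      show ?thesis unfolding eq insert_ident[OF nin] using wq wd by (simp add: doubleton_eq_iff)
    qed
  qed auto
  moreover have "inj_on P {..<2 * k + 3}"
  proof (rule linorder_inj_onI)
    fix i j assume ij: "i < j" "i \<in> {..<2 * k + 3}" "j \<in> {..<2 * k + 3}"
    \<comment> \<open>Exactly the pairs with index below \<open>2 * k\<close> contain
      \<open>x\<close>, and their other element \<open>q (Suc i)\<close> runs once around the
      cycle.\<close>
    have "j < 2 * k \<or> (i < 2 * k \<and> j \<ge> 2 * k) \<or> (i = 2 * k \<and> j = 2 * k + 1) \<or>
        (i = 2 * k \<and> j = 2 * k + 2) \<or> (i = 2 * k + 1 \<and> j = 2 * k + 2)"
      using ij unfolding lessThan_iff by linarith
    then consider "j < 2 * k" | "i < 2 * k" "j \<ge> 2 * k" | "i = 2 * k" "j = 2 * k + 1"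
      | "i = 2 * k" "j = 2 * k + 2" | "i = 2 * k + 1" "j = 2 * k + 2"
      by blast
    then show "P i \<noteq> P j"
    proof cases
      case 1
      then show ?thesis using qSuc[of i j] ij qx(1)[of "Suc i"] by (auto simp: P_def doubleton_eq_iff)
    next
      case 2
      then have "x \<in> P i" by (simp add: P_def)
      moreover have "x \<notin> {q 0, q (Suc 0), w, y}" using xy wd qx(1)[of "Suc 0"] k by auto
      then have "x \<notin> P j" using 2(2) by (simp add: P_def)
      ultimately show ?thesis by blast
    next
      case 3
      then show ?thesis using wd by (auto simp: P_def doubleton_eq_iff)
    next
      case 4
      then show ?thesis using wq by (auto simp: P_def doubleton_eq_iff)
    next
      case 5
      then show ?thesis using qx(2)[of "Suc 0"] qx(2)[of 0] k by (auto simp: P_def doubleton_eq_iff)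
    qed
  qed auto
  moreover have "full_triple G A (T i)" if "i < 2 * k + 3" for i
    using full fw f0 that by (simp add: T_def)
  moreover have "card (P i) = 2 \<and> P i \<subseteq> T i \<and> P i \<subseteq> T (Suc i mod (2 * k + 3))" if "i < 2 * k + 3" for i
  proof -
    have "Suc i < 2 * k \<or> Suc i = 2 * k \<or> i = 2 * k \<or> i = 2 * k + 1 \<or> i = 2 * k + 2"
      using that by linarith
    then consider "Suc i < 2 * k" | "Suc i = 2 * k" | "i = 2 * k" | "i = 2 * k + 1" | "i = 2 * k + 2"
      by blast
    then show ?thesis
    proof cases
      case 1
      then show ?thesis using qx(1)[of "Suc i"] by (auto simp: P_def T_def)
    next
      case 2
      then show ?thesis using qx(1)[of "Suc i"] q0 by (auto simp: P_def T_def)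
    next
      case 3
      then show ?thesis using wd by (auto simp: P_def T_def)
    next
      case 4
      then show ?thesis using wd by (auto simp: P_def T_def)
    next
      case 5
      then have "Suc i = 2 * k + 3" by simp
      then have "Suc i mod (2 * k + 3) = 0" by (simp only: mod_self)
      then show ?thesis using 5 q01 k by (auto simp: P_def T_def)
    qed
  qed
  ultimately show ?thesis by (intro simplicial_cycle_copy[OF G, where T = T and P = P and A = A]) simp_all
qed

section \<open>Counting full triples\<close>

lemma card_pairs_distinct:
  assumes "finite R"
  shows "card {(x, y). x \<in> R \<and> y \<in> R \<and> x \<noteq> y} = card R * (card R - 1)"
proof -
  have "{(x, y). x \<in> R \<and> y \<in> R \<and> x \<noteq> y} = (SIGMA x:R. R - {x})" by auto
  then show ?thesis using assms by (simp add: card_SigmaI)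
qed

lemma card_triples_distinct:
  assumes "finite R"
  shows "card {(u, v, x). u \<in> R \<and> v \<in> R \<and> x \<in> R \<and> u \<noteq> v \<and> u \<noteq> x \<and> v \<noteq> x} =
    card R * ((card R - 1) * (card R - 2))"
proof -
  have "{(u, v, x). u \<in> R \<and> v \<in> R \<and> x \<in> R \<and> u \<noteq> v \<and> u \<noteq> x \<and> v \<noteq> x} =
      (SIGMA u:R. SIGMA v:R - {u}. R - {u, v})" by auto
  moreover have "card (SIGMA v:R - {u}. R - {u, v}) = (card R - 1) * (card R - 2)" if "u \<in> R" for u
  proof -
    have "card (R - {u, v}) = card R - 2" if "v \<in> R - {u}" for v
      using that \<open>u \<in> R\<close> assms by (subst card_Diff_subset) auto
    then show ?thesis using assms that by (simp add: card_SigmaI)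
  qed
  ultimately show ?thesis using assms by (simp add: card_SigmaI)
qed

text \<open>Both sides count an element \<open>z\<close> together with an ordered pair of distinct
  members of \<open>R z\<close>. With \<open>z\<close> a pair uv and \<open>R z\<close> its set of
  apices, the right side is governed by what two apices have in common.\<close>

lemma sum_codegree_pairs:
  assumes "finite Z" "finite W" and R: "\<And>z. z \<in> Z \<Longrightarrow> R z \<subseteq> W"
  shows "(\<Sum>z\<in>Z. card (R z) * (card (R z) - 1)) =
    (\<Sum>(x, y)\<in>{(x, y). x \<in> W \<and> y \<in> W \<and> x \<noteq> y}. card {z\<in>Z. x \<in> R z \<and> y \<in> R z})"
proof -
  let ?O = "{(x, y). x \<in> W \<and> y \<in> W \<and> x \<noteq> y}"
  have O: "finite ?O" by (rule finite_subset[of _ "W \<times> W"]) (use assms(2) in auto)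
  have "(\<Sum>z\<in>Z. card (R z) * (card (R z) - 1)) = (\<Sum>z\<in>Z. card {e\<in>?O. fst e \<in> R z \<and> snd e \<in> R z})"
  proof (rule sum.cong)
    fix z assume z: "z \<in> Z"
    have "{e\<in>?O. fst e \<in> R z \<and> snd e \<in> R z} = {(x, y). x \<in> R z \<and> y \<in> R z \<and> x \<noteq> y}"
      using R[OF z] by auto
    moreover have "finite (R z)" using R[OF z] assms(2) by (rule finite_subset)
    ultimately show "card (R z) * (card (R z) - 1) = card {e\<in>?O. fst e \<in> R z \<and> snd e \<in> R z}"
      by (simp add: card_pairs_distinct)
  qed simp
  also have "\<dots> = (\<Sum>z\<in>Z. \<Sum>e\<in>?O. if fst e \<in> R z \<and> snd e \<in> R z then 1 else 0)"
    using O by (simp add: sum.If_cases Int_def)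
  also have "\<dots> = (\<Sum>e\<in>?O. \<Sum>z\<in>Z. if fst e \<in> R z \<and> snd e \<in> R z then 1 else 0)"
    by (rule sum.swap)
  also have "\<dots> = (\<Sum>e\<in>?O. card {z\<in>Z. fst e \<in> R z \<and> snd e \<in> R z})"
    using assms(1) by (simp add: sum.If_cases Int_def)
  finally show ?thesis by (simp add: case_prod_beta)
qed

text \<open>Summed over many \<open>c\<close>, this does the work of Cauchy-Schwarz. Expanding (c -
  B)^2 \<ge> 0 gives 2 B c \<le> c^2 + B^2, and one of the two terms B c absorbs the
  \<open>c\<close> lost in \<open>c * (c - 1)\<close>.\<close>

lemma quadratic_minorant:
  fixes B :: real
  assumes "B \<ge> 1"
  shows "B * real c \<le> real (c * (c - 1)) + B\<^sup>2"
proof (cases c)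
  case (Suc d)
  have "0 \<le> (real c - B)\<^sup>2" by simp
  then have "2 * B * real c \<le> (real c)\<^sup>2 + B\<^sup>2" by (simp add: power2_diff mult_ac)
  moreover have "real c \<le> B * real c" using assms by (simp add: mult_le_cancel_right1)
  ultimately show ?thesis using Suc by (simp add: power2_eq_square algebra_simps)
qed (use assms in simp)

text \<open>A pointwise stand-in for the power mean inequality: values up to \<open>4 * T\<close>
  are paid for by the last summand, and beyond that \<open>d - 1\<close> and \<open>d - 2\<close>
  are both at least \<open>T\<close>, the factor 4 leaving room for the subtraction.\<close>

lemma cubic_minorant:
  fixes T :: real
  assumes "T \<ge> 1"
  shows "real d \<le> real (d * ((d - 1) * (d - 2))) / T\<^sup>2 + 4 * T"
proof (cases "real d \<le> 4 * T")
  case True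
  then show ?thesis by (simp add: add_increasing)
next
  case False
  then have d: "real d > 4 * T" "d \<ge> 4" using assms by linarith+
  then have "T \<le> real (d - 1)" "T \<le> real (d - 2)" using assms by (simp_all add: of_nat_diff)
  then have "T * T \<le> real (d - 1) * real (d - 2)" using assms by (intro mult_mono) auto
  then have "real d * T\<^sup>2 \<le> real (d * ((d - 1) * (d - 2)))"
    by (simp add: power2_eq_square mult_left_mono)
  then have "real d \<le> real (d * ((d - 1) * (d - 2))) / T\<^sup>2"
    using assms by (simp add: pos_le_divide_eq)
  then show ?thesis using assms by linarith
qed

section \<open>Full triples in subgraphs of the cube\<close>

lemma hypercube_edge_subset:
  assumes "subgraph G (hypercube n)" "{X, Y} \<in> edges G"
  shows "X \<subseteq> {1..n}" "Y \<subseteq> {1..n}"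
proof -
  have "{X, Y} \<in> edges (hypercube n)" using assms by (auto simp: subgraph_def)
  then show "X \<subseteq> {1..n}" "Y \<subseteq> {1..n}" by (auto simp: hypercube_def doubleton_eq_iff)
qed

lemma full_triple_subset:
  assumes "subgraph G (hypercube n)" "full_triple G A T"
  shows "A \<union> T \<subseteq> {1..n}"
proof -
  have "T \<noteq> {}" using assms(2) by (auto simp: full_triple_def)
  then obtain s where "{A \<union> T - {s}, A \<union> T} \<in> edges G" using assms(2) by (auto simp: full_triple_def)
  from hypercube_edge_subset(2)[OF assms(1) this] show ?thesis .
qed

lemma common_link_bound:
  assumes G: "subgraph G (hypercube n)" and k: "k \<ge> 2"
    and free: "\<not> contains_copy G (cycle_graph (2 * (2 * k + 3)))"
    and M: "M \<ge> 1" "n < M ^ k" and xy: "x \<noteq> y"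
  shows "card {(u, v). full_triple G A {u, v, x} \<and> full_triple G A {u, v, y}} \<le>
    2 * ((2 * k + 3) * (M + 5)) * n"
proof (rule ccontr)
  define E where "E = {(u, v). full_triple G A {u, v, x} \<and> full_triple G A {u, v, y}}"
  assume "\<not> ?thesis"
  then have "card E > 2 * ((2 * k + 3) * (M + 5)) * card {1..n}" by (simp add: E_def)
  moreover have "E \<subseteq> {1..n} \<times> {1..n}"
    using full_triple_subset[OF G] by (fastforce simp: E_def)
  moreover have "sym E" by (auto simp: sym_def E_def insert_commute)
  moreover have "irrefl E" using full_triple_distinct unfolding irrefl_def E_def by blast
  ultimately obtain p w where "length p = 2 * k" "distinct p" "successively (\<lambda>u v. (u, v) \<in> E) p"
    "(last p, hd p) \<in> E" "(hd p, w) \<in> E" "w \<noteq> p ! 1" "w \<noteq> last p"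
    using even_cycle_with_pendant_edge[of "{1..n}" E k M] k M by auto
  moreover have "simple_graph G" using G by (simp add: subgraph_def)
  ultimately have "contains_copy G (cycle_graph (2 * (2 * k + 3)))"
    using k xy E_def by (intro cycle_copy_of_common_link[of G k x y E A p w]) auto
  with free show False by contradiction
qed

lemma full_triples_bound:
  assumes G: "subgraph G (hypercube n)" and k: "k \<ge> 2" and n: "n \<ge> 1"
    and free: "\<not> contains_copy G (cycle_graph (2 * (2 * k + 3)))"
  shows "real (card {(u, v, x). full_triple G A {u, v, x}}) \<le>
    (14 * (2 * real k + 3) + 1) * (real n)\<^sup>2 * real n powr (1 / 2 + 1 / (2 * real k))"
proof -
  define W where "W = {1..n}"
  \<comment> \<open>\<open>M\<close> is the least integer above \<open>b\<close>, so
    \<open>n < M ^ k\<close>, and \<open>M + 5\<close> is at most \<open>7 * b\<close>; this 7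
    doubles to the 14 of the bound. \<open>B\<close> is chosen with B^2 = n b, so that the codegree
    sum, of order n^3 b, and the error B^2 summed over n^2 pairs balance.\<close>
  define b where "b = real n powr (1 / real k)"
  define B where "B = real n powr (1 / 2 + 1 / (2 * real k))"
  define M where "M = nat \<lfloor>b\<rfloor> + 1"
  define R where "R = (\<lambda>(u, v). {x. full_triple G A {u, v, x}})"
  define h where "h = card {(u, v, x). full_triple G A {u, v, x}}"
  have b1: "b \<ge> 1" and B1: "B \<ge> 1" using n by (auto simp: b_def B_def ge_one_powr_ge_zero)
  have B2: "B\<^sup>2 = real n * b"
  proof -
    have "B\<^sup>2 = real n powr ((1 / 2 + 1 / (2 * real k)) * 2)"
      using n by (simp add: B_def powr_powr flip: powr_numeral)
    also have "(1 / 2 + 1 / (2 * real k)) * 2 = 1 + 1 / real k" by (simp add: algebra_simps)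
    finally show ?thesis using n by (simp add: b_def powr_add)
  qed
  have bM: "b < real M" and M7: "real (M + 5) \<le> 7 * b" using b1 unfolding M_def by linarith+
  have "real n = b ^ k"
    using n k by (simp add: b_def powr_powr flip: powr_realpow)
  also have "\<dots> < real M ^ k" using bM b1 k by (intro power_strict_mono) auto
  finally have nM: "n < M ^ k" by (metis of_nat_less_iff of_nat_power)
  have RW: "R z \<subseteq> W" for z
    using full_triple_subset[OF G] by (fastforce simp: R_def W_def)
  have "{(u, v, x). full_triple G A {u, v, x}} = (\<lambda>((u, v), x). (u, v, x)) ` (SIGMA z:W \<times> W. R z)"
    using full_triple_subset[OF G] by (fastforce simp: R_def W_def image_iff)
  then have "h = card (SIGMA z:W \<times> W. R z)"
    unfolding h_def by (auto intro!: card_image simp: inj_on_def)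
  also have "\<dots> = (\<Sum>z\<in>W \<times> W. card (R z))"
    using RW by (intro card_SigmaI) (auto simp: W_def intro: finite_subset)
  finally have h: "h = (\<Sum>z\<in>W \<times> W. card (R z))" .
  let ?O = "{(x, y). x \<in> W \<and> y \<in> W \<and> x \<noteq> y}"
  have "(\<Sum>z\<in>W \<times> W. card (R z) * (card (R z) - 1)) =
      (\<Sum>(x, y)\<in>?O. card {z\<in>W \<times> W. x \<in> R z \<and> y \<in> R z})"
    using RW by (intro sum_codegree_pairs) (auto simp: W_def)
  also have "\<dots> \<le> (\<Sum>e\<in>?O. 2 * ((2 * k + 3) * (M + 5)) * n)"
  proof (rule sum_mono, clarify)
    fix x y :: nat assume xy: "x \<noteq> y"
    have "{z\<in>W \<times> W. x \<in> R z \<and> y \<in> R z} = {(u, v). full_triple G A {u, v, x} \<and> full_triple G A {u, v, y}}"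
      using full_triple_subset[OF G] by (fastforce simp: R_def W_def)
    then show "card {z\<in>W \<times> W. x \<in> R z \<and> y \<in> R z} \<le> 2 * ((2 * k + 3) * (M + 5)) * n"
      using common_link_bound[OF G k free _ nM xy, of A] by (simp add: M_def)
  qed
  also have "\<dots> = card ?O * (2 * ((2 * k + 3) * (M + 5)) * n)" by simp
  also have "\<dots> \<le> (n * n) * (2 * ((2 * k + 3) * (M + 5)) * n)"
  proof (rule mult_le_mono1)
    have "?O \<subseteq> W \<times> W" by auto
    then have "card ?O \<le> card (W \<times> W)" by (intro card_mono) (auto simp: W_def)
    then show "card ?O \<le> n * n" by (simp add: W_def card_cartesian_product)
  qed
  finally have "real (\<Sum>z\<in>W \<times> W. card (R z) * (card (R z) - 1)) \<le>
      real ((n * n) * (2 * ((2 * k + 3) * (M + 5)) * n))" by (simp only: of_nat_le_iff)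
  also have "\<dots> = 2 * (2 * real k + 3) * (real n)^3 * real (M + 5)"
    by (simp add: power3_eq_cube)
  also have "\<dots> \<le> 2 * (2 * real k + 3) * (real n)^3 * (7 * b)"
    by (rule mult_left_mono[OF M7]) simp
  also have "\<dots> = 14 * (2 * real k + 3) * (real n)^3 * b" by simp
  finally have S: "real (\<Sum>z\<in>W \<times> W. card (R z) * (card (R z) - 1)) \<le> 14 * (2 * real k + 3) * (real n)^3 * b" .
  have "B * real h = (\<Sum>z\<in>W \<times> W. B * real (card (R z)))" by (simp add: h sum_distrib_left)
  also have "\<dots> \<le> (\<Sum>z\<in>W \<times> W. real (card (R z) * (card (R z) - 1)) + B\<^sup>2)"
    by (intro sum_mono quadratic_minorant B1)
  also have "\<dots> = real (\<Sum>z\<in>W \<times> W. card (R z) * (card (R z) - 1)) + (real n)\<^sup>2 * B\<^sup>2"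
    by (simp add: sum.distrib W_def card_cartesian_product power2_eq_square)
  also have "\<dots> \<le> 14 * (2 * real k + 3) * (real n)^3 * b + (real n)\<^sup>2 * B\<^sup>2"
    using S by simp
  also have "\<dots> = B * ((14 * (2 * real k + 3) + 1) * (real n)\<^sup>2 * B)"
  proof -
    have "(real n)^3 * b = (real n)\<^sup>2 * (B * B)" using B2 by (simp add: power3_eq_cube power2_eq_square)
    then have "14 * (2 * real k + 3) * ((real n)^3 * b) = 14 * (2 * real k + 3) * ((real n)\<^sup>2 * (B * B))" by simp
    then show ?thesis by (simp add: algebra_simps power2_eq_square)
  qed
  finally have "real h \<le> (14 * (2 * real k + 3) + 1) * (real n)\<^sup>2 * B"
    using B1 by (simp only: mult_le_cancel_left_pos)
  then show ?thesis by (simp only: h_def B_def)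
qed

lemma card_edges_le_sum_down_degrees:
  assumes G: "subgraph G (hypercube n)"
  shows "card (edges G) \<le> (\<Sum>X\<in>Pow {1..n}. card {s\<in>X. {X - {s}, X} \<in> edges G})"
proof -
  let ?S = "SIGMA X:Pow {1..n}. {s\<in>X. {X - {s}, X} \<in> edges G}"
  have fin: "finite {s\<in>X. {X - {s}, X} \<in> edges G}" if "X \<in> Pow {1..n}" for X
    using that finite_subset[of X "{1..n}"] by auto
  have "edges G \<subseteq> (\<lambda>(X, s). {X - {s}, X}) ` ?S"
  proof
    fix e assume e: "e \<in> edges G"
    then have "e \<in> edges (hypercube n)" using G by (auto simp: subgraph_def)
    then obtain X Y where XY: "e = {X, Y}" "X \<subseteq> {1..n}" "Y \<subseteq> {1..n}" "X \<subseteq> Y" "card Y = card X + 1"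
      by (auto simp: hypercube_def)
    then have "card (Y - X) = 1" by (simp add: card_Diff_subset finite_subset)
    then obtain s where "Y - X = {s}" by (auto simp: card_1_singleton_iff)
    then have "X = Y - {s}" "s \<in> Y" using XY(4) by auto
    then show "e \<in> (\<lambda>(X, s). {X - {s}, X}) ` ?S" using XY e by (intro image_eqI[of _ _ "(Y, s)"]) auto
  qed
  then have "card (edges G) \<le> card ?S" using fin by (intro surj_card_le) auto
  also have "\<dots> = (\<Sum>X\<in>Pow {1..n}. card {s\<in>X. {X - {s}, X} \<in> edges G})"
    using fin by (intro card_SigmaI) auto
  finally show ?thesis .
qed

text \<open>Three distinct elements along which \<open>X\<close> has downward edges form a full
  triple over the rest of \<open>X\<close>, and \<open>X\<close> is recovered as the union of the
  two, so the correspondence is injective.\<close>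

lemma sum_down_triples_le:
  assumes G: "subgraph G (hypercube n)"
  defines "d \<equiv> \<lambda>X. card {s\<in>X. {X - {s}, X} \<in> edges G}"
  shows "(\<Sum>X\<in>Pow {1..n}. d X * ((d X - 1) * (d X - 2))) \<le>
    (\<Sum>A\<in>Pow {1..n}. card {(u, v, x). full_triple G A {u, v, x}})"
proof -
  define Dn where "Dn X = {s\<in>X. {X - {s}, X} \<in> edges G}" for X
  define Q where "Q X = {(u, v, x). u \<in> Dn X \<and> v \<in> Dn X \<and> x \<in> Dn X \<and> u \<noteq> v \<and> u \<noteq> x \<and> v \<noteq> x}" for X
  define H where "H A = {(u, v, x). full_triple G A {u, v, x}}" for A
  let ?f = "\<lambda>(X, (u, v, x)). (X - {u, v, x}, (u, v, x))"
  have finD: "finite (Dn X)" if "X \<in> Pow {1..n}" for X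
    using that finite_subset[of X "{1..n}"] by (auto simp: Dn_def)
  have finQ: "finite (Q X)" if "X \<in> Pow {1..n}" for X
    by (rule finite_subset[of _ "Dn X \<times> Dn X \<times> Dn X"]) (use finD[OF that] in \<open>auto simp: Q_def\<close>)
  have finH: "finite (H A)" for A
    by (rule finite_subset[of _ "{1..n} \<times> {1..n} \<times> {1..n}"])
      (use full_triple_subset[OF G] in \<open>fastforce simp: H_def\<close>)+
  have "(\<Sum>X\<in>Pow {1..n}. d X * ((d X - 1) * (d X - 2))) = (\<Sum>X\<in>Pow {1..n}. card (Q X))"
    unfolding Q_def d_def Dn_def[symmetric]
    by (intro sum.cong refl card_triples_distinct[symmetric] finD)
  also have "\<dots> = card (SIGMA X:Pow {1..n}. Q X)" using finQ by (simp add: card_SigmaI)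
  also have "\<dots> \<le> card (SIGMA A:Pow {1..n}. H A)"
  proof (rule card_inj_on_le[of ?f])
    show "inj_on ?f (SIGMA X:Pow {1..n}. Q X)"
    proof (rule inj_onI, clarsimp)
      fix X Y u v x
      assume "(u, v, x) \<in> Q X" "(u, v, x) \<in> Q Y" "X - {u, v, x} = Y - {u, v, x}"
      moreover from this have "{u, v, x} \<subseteq> X" "{u, v, x} \<subseteq> Y" by (auto simp: Q_def Dn_def)
      ultimately show "X = Y" by blast
    qed
    show "?f ` (SIGMA X:Pow {1..n}. Q X) \<subseteq> (SIGMA A:Pow {1..n}. H A)"
    proof clarsimp
      fix X u v x assume X: "X \<subseteq> {Suc 0..n}" and q: "(u, v, x) \<in> Q X"
      then have "X - {u, v, x} \<union> {u, v, x} = X" by (auto simp: Q_def Dn_def)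
      then have "full_triple G (X - {u, v, x}) {u, v, x}"
        using q unfolding full_triple_def by (auto simp: Q_def Dn_def)
      then show "X - {u, v, x} \<subseteq> {Suc 0..n} \<and> (u, v, x) \<in> H (X - {u, v, x})" using X by (auto simp: H_def)
    qed
    show "finite (SIGMA A:Pow {1..n}. H A)" using finH by (intro finite_SigmaI) auto
  qed
  also have "\<dots> = (\<Sum>A\<in>Pow {1..n}. card (H A))" using finH by (simp add: card_SigmaI)
  finally show ?thesis by (simp only: H_def)
qed

lemma card_edges_cycle_free_le:
  assumes G: "subgraph G (hypercube n)" and k: "k \<ge> 2" and n: "n \<ge> 1"
    and free: "\<not> contains_copy G (cycle_graph (2 * (2 * k + 3)))"
  shows "real (card (edges G)) \<le>
    (14 * (2 * real k + 3) + 5) * (real n powr (5 / 6 + 1 / (6 * real k)) * 2 ^ n)"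
proof -
  define K where "K = 14 * (2 * real k + 3) + 1"
  \<comment> \<open>Up to the factor \<open>K\<close>, T^3 is the bound on full triples over one set
    \<open>A\<close>. After division by T^2 the cubic sum contributes \<open>K * T\<close> per set,
    and the error of \<open>cubic_minorant\<close> adds \<open>4 * T\<close>.\<close>
  define T where "T = real n powr (5 / 6 + 1 / (6 * real k))"
  define d where "d X = card {s\<in>X. {X - {s}, X} \<in> edges G}" for X
  have T1: "T \<ge> 1" using n by (auto simp: T_def intro!: ge_one_powr_ge_zero)
  have T3: "(real n)\<^sup>2 * real n powr (1 / 2 + 1 / (2 * real k)) = T * T\<^sup>2"
  proof -
    have "(real n)\<^sup>2 * real n powr (1 / 2 + 1 / (2 * real k)) = real n powr (2 + (1 / 2 + 1 / (2 * real k)))"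
      using powr_add[of "real n" 2 "1 / 2 + 1 / (2 * real k)"] n by (simp only: powr_numeral of_nat_0_le_iff)
    also have "2 + (1 / 2 + 1 / (2 * real k)) = (5 / 6 + 1 / (6 * real k)) * 3" by (simp add: field_simps)
    also have "real n powr \<dots> = T ^ 3" using n by (simp add: T_def powr_powr flip: powr_numeral)
    finally show ?thesis by (simp add: power3_eq_cube power2_eq_square)
  qed
  have "real (\<Sum>X\<in>Pow {1..n}. d X * ((d X - 1) * (d X - 2))) \<le>
      real (\<Sum>A\<in>Pow {1..n}. card {(u, v, x). full_triple G A {u, v, x}})"
    unfolding of_nat_le_iff d_def by (rule sum_down_triples_le[OF G])
  also have "\<dots> \<le> (\<Sum>A\<in>Pow {1..n}. K * (T * T\<^sup>2))"
    unfolding of_nat_sum using full_triples_bound[OF G k n free]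
    by (intro sum_mono) (simp add: K_def T3[symmetric] mult.assoc)
  also have "\<dots> = 2 ^ n * (K * T) * T\<^sup>2" by (simp add: card_Pow mult.assoc)
  finally have D: "real (\<Sum>X\<in>Pow {1..n}. d X * ((d X - 1) * (d X - 2))) / T\<^sup>2 \<le> 2 ^ n * (K * T)"
    using T1 by (simp add: pos_divide_le_eq)
  have "real (card (edges G)) \<le> real (\<Sum>X\<in>Pow {1..n}. d X)"
    unfolding of_nat_le_iff d_def by (rule card_edges_le_sum_down_degrees[OF G])
  also have "\<dots> \<le> (\<Sum>X\<in>Pow {1..n}. real (d X * ((d X - 1) * (d X - 2))) / T\<^sup>2 + 4 * T)"
    unfolding of_nat_sum by (intro sum_mono cubic_minorant T1)
  also have "\<dots> = real (\<Sum>X\<in>Pow {1..n}. d X * ((d X - 1) * (d X - 2))) / T\<^sup>2 + 2 ^ n * (4 * T)"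
    by (simp add: sum.distrib sum_divide_distrib card_Pow)
  also have "\<dots> \<le> 2 ^ n * (K * T) + 2 ^ n * (4 * T)" using D by simp
  finally show ?thesis by (simp add: K_def T_def algebra_simps)
qed

theorem theorem1:
  fixes l :: nat
  assumes "odd l" and "l \<ge> 7"
  shows "(\<lambda>n::nat. real (ex_number (hypercube n) (cycle_graph (2 * l))))
           \<in> O[at_top](\<lambda>n. real n powr (5 / 6 + 1 / (3 * (real l - 3))) * 2 ^ n)"
proof -
  obtain j where j: "l = 2 * j + 1" using assms(1) by (auto elim: oddE)
  \<comment> \<open>The detour accounts for 3 of the \<open>l\<close> triples and the even cycle for
    \<open>2 * k\<close>; \<open>l \<ge> 7\<close> makes that cycle have length at least 4.\<close>
  define k where "k = j - 1"
  have l: "l = 2 * k + 3" and k: "k \<ge> 2" using j assms(2) by (simp_all add: k_def)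
  have exponent: "3 * (real l - 3) = 6 * real k" by (simp add: l)
  have "real (ex_number (hypercube n) (cycle_graph (2 * l))) \<le>
      (14 * (2 * real k + 3) + 5) * (real n powr (5 / 6 + 1 / (6 * real k)) * 2 ^ n)" if n: "n \<ge> 1" for n
  proof -
    have "0 \<in> verts (cycle_graph (2 * l))" using assms(2) by (simp add: cycle_graph_def)
    then have "verts (cycle_graph (2 * l)) \<noteq> {}" by blast
    \<comment> \<open>Since the maximum is over a finite nonempty set, it is attained by some
      extremal \<open>G\<close>.\<close>
    from Max_in[OF ex_number_well_defined[OF finite_edges_hypercube this]]
    obtain G where "subgraph G (hypercube n)" "\<not> contains_copy G (cycle_graph (2 * l))"
      "ex_number (hypercube n) (cycle_graph (2 * l)) = card (edges G)"
      unfolding ex_number_def by blast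
    then show ?thesis using card_edges_cycle_free_le[of G n k] k n by (simp add: l)
  qed
  then show ?thesis
    unfolding exponent
    by (intro bigoI[of _ "14 * (2 * real k + 3) + 5"] eventually_mono[OF eventually_ge_at_top[of 1]]) auto
qed

end
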